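(* The function $x\mapsto \lambda\left(\frac{\pi}{x}\right)-\frac{\pi}{x}$ (extended over its removable singularity at $x=0$) is analytic in $(-\pi,\pi)$, and its Maclaurin series is $$\lambda\left(\frac{\pi}{x}\right)-\frac{\pi}{x}=\frac{\pi^2}{6}-1+\left(\frac{\pi^3}{72}-\frac{\pi}{6}\right)x+\left(\frac{\pi^4}{1296}-\frac{\pi^2}{120}\right)x^2+\cdots,$$ that is, its coefficients of $x^0,x^1,x^2$ are the displayed ones. Moreover, writing $\sum_{n\ge 0}c_nx^n$ for this Maclaurin series (so $c_0=\frac{\pi^2}{6}-1$, $c_1=\frac{\pi^3}{72}-\frac{\pi}{6}$, $c_2=\frac{\pi^4}{1296}-\frac{\pi^2}{120}$), one has for all $1<p<\infty$ $$\lambda(p)=p+\sum_{n\ge 0}c_n\left(\frac{\pi}{p}\right)^n=p+\frac{\pi^2}{6}-1+\left(\frac{\pi^3}{72}-\frac{\pi}{6}\right)\frac{\pi}{p}+\left(\frac{\pi^4}{1296}-\frac{\pi^2}{120}\right)\left(\frac{\pi}{p}\right)^2+\cdots.$$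
   Context: For $1<p<\infty$, $\lambda(p)$ denotes the first (smallest) eigenvalue of the one-dimensional $p$-Laplacian on $(-1,1)$ with Dirichlet boundary conditions, i.e. the smallest $\lambda$ for which $(|u'|^{p-2}u')'+\lambda|u|^{p-2}u=0$ in $(-1,1)$, $u(-1)=u(1)=0$ has a nontrivial solution. It is known to be given explicitly by $$\lambda(p)=(p-1)\left(\frac{\pi}{p\sin(\pi/p)}\right)^p,$$ and this formula may be taken as the definition of $\lambda(p)$. For $x\in(-\pi,\pi)\setminus\{0\}$, the expression $\lambda(\pi/x)$ is understood through this formula with $p=\pi/x$, i.e. $$\lambda\left(\frac{\pi}{x}\right)=\left(\frac{\pi}{x}-1\right)\left(\frac{x}{\sin x}\right)^{\pi/x},$$ where $x/\sin x>0$; this also gives meaning to the expression for $x<0$. *)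

theory Defs
  imports "HOL-Complex_Analysis.Complex_Analysis"
begin

text \<open>
  First Dirichlet eigenvalue of the one-dimensional \<open>p\<close>-Laplacian on \<open>(-1,1)\<close>, given by its
  closed form. The formula is also used for \<open>p = pi / x\<close> with \<open>- pi < x < 0\<close>, i.e. for
  \<open>p < - 1\<close>. The base of \<open>powr\<close> is positive whenever \<open>\<bar>p\<bar> > 1\<close>.
\<close>

definition plap_eigenvalue :: "real \<Rightarrow> real" where
  "plap_eigenvalue p = (p - 1) * (pi / (p * sin (pi / p))) powr p"

definition shifted_eigenvalue :: "real \<Rightarrow> real" where
  "shifted_eigenvalue x =
     (if x = 0 then Lim (at 0) (\<lambda>y. plap_eigenvalue (pi / y) - pi / y)
      else plap_eigenvalue (pi / x) - pi / x)"

text \<open>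
  The library's \<open>analytic_on\<close> is restricted to complex functions. Here, every point of \<open>S\<close> has a
  neighbourhood in the whole real line on which \<open>f\<close> is the sum of a power series.
\<close>

definition real_analytic_on :: "(real \<Rightarrow> real) \<Rightarrow> real set \<Rightarrow> bool" where
  "real_analytic_on f S \<longleftrightarrow> (\<forall>x\<in>S. \<exists>F. (\<lambda>h. f (x + h)) has_fps_expansion F)"

definition maclaurin_coeff :: "(real \<Rightarrow> real) \<Rightarrow> nat \<Rightarrow> real" where
  "maclaurin_coeff f n = (deriv ^^ n) f 0 / fact n"

end

theory Submission
  imports Defs
begin

text \<open>
  For \<open>0 < \<bar>x\<bar> < \<pi>\<close> the closed form reads
  \<open>\<lambda>(\<pi>/x) - \<pi>/x = \<pi> * (exp (E x) - 1) / x - exp (E x)\<close> with \<open>E x = - \<pi> * ln (sin x / x) / x\<close>.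
  The right-hand side extends holomorphically to the complex disc of radius \<open>\<pi>\<close>. Indeed
  \<open>sin z / z\<close> has no zero there, so it has a holomorphic logarithm, which can be chosen real on the
  real axis and zero at the origin (\<open>ex_log_sinc\<close>); the two remaining divisions by \<open>z\<close> are difference
  quotients at \<open>0\<close> of holomorphic functions and hence have removable singularities
  (\<open>slope0_holomorphic\<close>). A function holomorphic in a disc is the sum of its Taylor series in the
  whole disc, and on the real axis one may take real parts of the coefficients
  (\<open>sums_Re_of_holomorphic\<close>). This gives analyticity, convergence on all of \<open>(-\<pi>, \<pi>)\<close> and, with
  \<open>x = \<pi> / p\<close>, the expansion of \<open>\<lambda>(p)\<close> for every \<open>p > 1\<close>.

  The coefficients come from formal power series. The logarithm is
  \<open>- z^2/6 - z^4/180 + \<dots>\<close>, so \<open>E z = \<pi> z/6 + \<pi> z^3/180 + \<dots>\<close>, and the coefficients of \<open>exp (E z)\<close> up to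
  \<open>z^3\<close> determine the three displayed ones (\<open>ex_shifted_eigenvalue_extension\<close>).
\<close>

section \<open>Restricting complex power series to the real line\<close>

text \<open>The counterpart for real functions of \<open>fps_nth_fps_expansion\<close>, which is about complex functions.\<close>

lemma real_has_fps_expansion_nth:
  fixes f :: "real \<Rightarrow> real"
  assumes "f has_fps_expansion F"
  shows "fps_nth F n = (deriv ^^ n) f 0 / fact n"
proof -
  have "(deriv ^^ n) f has_fps_expansion (fps_deriv ^^ n) F"
    by (induction n) (auto intro: assms has_fps_expansion_deriv)
  then have "(deriv ^^ n) f 0 = fps_nth ((fps_deriv ^^ n) F) 0"
    by (simp add: has_fps_expansion_imp_0_eq_fps_nth_0)
  then show ?thesis
    by (simp add: fps_0th_higher_deriv)
qed

text \<open>
  The complex function need not be real on the real axis: its real part there is still the sum of a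
  real power series, on the whole interval cut out by the disc.
\<close>

lemma sums_Re_of_holomorphic:
  assumes "F holomorphic_on ball (of_real a) r" "\<bar>h\<bar> < r"
  shows "(\<lambda>n. Re (fps_nth (fps_expansion F (of_real a)) n) * h ^ n) sums Re (F (of_real (a + h)))"
proof -
  have "(\<lambda>n. (deriv ^^ n) F (of_real a) / fact n * (of_real (a + h) - of_real a) ^ n)
          sums F (of_real (a + h))"
    using assms by (intro holomorphic_power_series[of F "of_real a" r]) (auto simp: dist_norm)
  then have "(\<lambda>n. fps_nth (fps_expansion F (of_real a)) n * of_real (h ^ n)) sums F (of_real (a + h))"
    by (simp add: fps_expansion_def)
  from sums_Re[OF this] show ?thesis by simp
qed

lemma real_analytic_on_Re_holomorphic:
  assumes F: "F holomorphic_on A" "open A"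
    and sub: "\<And>x. x \<in> S \<Longrightarrow> of_real x \<in> A"
    and eq: "\<And>x. x \<in> S \<Longrightarrow> f x = Re (F (of_real x))"
    and S: "open S"
  shows "real_analytic_on f S"
  unfolding real_analytic_on_def
proof
  fix x assume x: "x \<in> S"
  obtain r where r: "r > 0" "ball (complex_of_real x) r \<subseteq> A"
    using F(2) sub[OF x] open_contains_ball by blast
  obtain d where d: "d > 0" "ball x d \<subseteq> S"
    using S x open_contains_ball by blast
  define C where "C = Abs_fps (\<lambda>n. Re (fps_nth (fps_expansion F (of_real x)) n))"
  have "eventually (\<lambda>h. h \<in> ball 0 (min r d)) (nhds (0::real))"
    using r(1) d(1) by (intro eventually_nhds_in_open) auto
  then have "eventually (\<lambda>h. (\<lambda>n. fps_nth C n * h ^ n) sums f (x + h)) (nhds 0)"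
  proof eventually_elim
    case (elim h)
    then have "x + h \<in> S" using d(2) by (intro subsetD[OF d(2)]) (auto simp: dist_norm)
    moreover have "F holomorphic_on ball (of_real x) r"
      using F(1) r(2) by (rule holomorphic_on_subset)
    ultimately show ?case
      using sums_Re_of_holomorphic[of F x r h] elim by (simp add: C_def eq)
  qed
  then have "(\<lambda>h. f (x + h)) has_fps_expansion C"
    by (rule has_fps_expansionI)
  then show "\<exists>C. (\<lambda>h. f (x + h)) has_fps_expansion C" ..
qed

section \<open>Difference quotients at the origin\<close>

text \<open>
  The difference quotient of \<open>f\<close> between \<open>0\<close> and \<open>z\<close>, with the derivative as its value at \<open>0\<close>. In
  particular \<open>slope0 sin\<close> is the cardinal sine \<open>sin z / z\<close> extended by \<open>1\<close>.
\<close>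

definition slope0 :: "(complex \<Rightarrow> complex) \<Rightarrow> complex \<Rightarrow> complex" where
  "slope0 f z = (if z = 0 then deriv f 0 else (f z - f 0) / z)"

lemma slope0_holomorphic:
  assumes "f holomorphic_on A" "open A"
  shows "slope0 f holomorphic_on A"
  unfolding slope0_def by (rule pole_lemma_open[OF assms, of 0, unfolded diff_zero])

lemma slope0_has_fps_expansion:
  assumes "f has_fps_expansion F"
  shows "slope0 f has_fps_expansion fps_shift 1 F"
proof -
  have f0: "f 0 = fps_nth F 0"
    using assms by (simp add: has_fps_expansion_imp_0_eq_fps_nth_0)
  have d0: "deriv f 0 = fps_nth F 1"
    using fps_nth_fps_expansion[OF assms, of 1] by simp
  have "eventually (\<lambda>z. z \<in> eball 0 (fps_conv_radius F)) (nhds 0)"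
    using assms by (intro eventually_nhds_in_open) (auto simp: has_fps_expansion_def zero_ereal_def)
  moreover have "eventually (\<lambda>z. eval_fps F z = f z) (nhds 0)"
    using assms by (simp add: has_fps_expansion_def)
  ultimately have "eventually (\<lambda>z. (\<lambda>n. fps_nth (fps_shift 1 F) n * z ^ n) sums slope0 f z) (nhds 0)"
  proof eventually_elim
    case (elim z)
    show ?case
    proof (cases "z = 0")
      case True
      then show ?thesis
        using powser_sums_zero[of "fps_nth (fps_shift 1 F)"] by (simp add: slope0_def d0)
    next
      case False
      have "(\<lambda>n. fps_nth F n * z ^ n) sums f z"
        using sums_eval_fps[of z F] elim by (simp add: in_eball_iff)
      then have "(\<lambda>n. fps_nth F (Suc n) * z ^ Suc n) sums (f z - f 0)"
        by (subst sums_Suc_iff) (simp add: f0)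
      from sums_divide[OF this, of z] show ?thesis
        using False by (simp add: slope0_def)
    qed
  qed
  then show ?thesis by (rule has_fps_expansionI)
qed

section \<open>A logarithm of the cardinal sine\<close>

lemma slope0_sin: "slope0 sin z = (if z = 0 then 1 else sin z / z)"
  by (simp add: slope0_def DERIV_imp_deriv[OF DERIV_sin])

lemma slope0_sin_holomorphic: "slope0 sin holomorphic_on A"
  by (rule holomorphic_on_subset[OF slope0_holomorphic[of _ UNIV]])
     (auto intro: holomorphic_on_sin holomorphic_on_ident)

lemma slope0_sin_nonzero:
  assumes "z \<in> ball 0 pi"
  shows "slope0 sin z \<noteq> 0"
proof
  assume "slope0 sin z = 0"
  then have "z \<noteq> 0" "sin z = 0" by (auto simp: slope0_sin split: if_splits)
  then obtain n :: int where n: "z = of_real (n * pi)" "n \<noteq> 0"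
    by (auto simp: sin_eq_0)
  then have "norm z = \<bar>n\<bar> * pi" by (simp add: norm_mult abs_mult)
  moreover have "\<bar>real_of_int n\<bar> \<ge> 1" using n(2) by linarith
  ultimately have "norm z \<ge> pi" using mult_right_mono[of 1 "\<bar>real_of_int n\<bar>" pi] by simp
  then show False using assms by simp
qed

lemma slope0_sin_cnj: "slope0 sin (cnj z) = cnj (slope0 sin z)"
  by (simp add: slope0_sin cnj_sin)

lemma sinc_pos:
  assumes "\<bar>x\<bar> < pi" "x \<noteq> 0"
  shows "sin x / x > (0::real)"
proof (cases "x > 0")
  case True
  then show ?thesis using assms sin_gt_zero[of x] by simp
next
  case False
  then have "sin (-x) > 0" using assms by (intro sin_gt_zero) auto
  then show ?thesis using False assms by (simp add: divide_neg_neg)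
qed

text \<open>
  The equation for \<open>exp (2 * m z)\<close> instead of \<open>exp (m z)\<close> is what symmetrising a logarithm under
  complex conjugation gives without any discussion of branches; together with \<open>m 0 = 0\<close> it
  still determines all Taylor coefficients of \<open>m\<close>.
\<close>

lemma ex_log_sinc:
  obtains m :: "complex \<Rightarrow> complex"
  where "m holomorphic_on ball 0 pi" "m 0 = 0"
    and "\<And>x. \<bar>x\<bar> < pi \<Longrightarrow> x \<noteq> 0 \<Longrightarrow> m (of_real x) = of_real (ln (sin x / x))"
    and "\<And>z. z \<in> ball 0 pi \<Longrightarrow> exp (2 * m z) = slope0 sin z ^ 2"
proof -
  obtain l where l: "l holomorphic_on ball 0 pi"
    and exp_l: "\<And>z. z \<in> ball 0 pi \<Longrightarrow> exp (l z) = slope0 sin z"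
    using holomorphic_logarithm_exists[of "ball (0::complex) pi" "slope0 sin" 0]
      slope0_sin_holomorphic slope0_sin_nonzero pi_gt_zero
    by (metis centre_in_ball convex_ball open_ball)
  \<comment> \<open>On the real axis this is the real part of \<open>l\<close>, hence the real logarithm of the modulus of
     \<open>sin x / x\<close>, whichever branch \<open>l\<close> is.\<close>
  define m where "m = (\<lambda>z. (l z + cnj (l (cnj z))) / 2)"
  have "cnj ` ball 0 pi = ball 0 pi"
    unfolding image_cnj_conv_vimage_cnj by auto
  then have "cnj \<circ> l \<circ> cnj holomorphic_on ball 0 pi"
    using l by (intro holomorphic_on_compose_cnj_cnj) auto
  then have "m holomorphic_on ball 0 pi"
    unfolding m_def using l by (intro holomorphic_intros) (auto simp: o_def)
  moreover have m_real: "m (of_real x) = of_real (ln (Re (slope0 sin (of_real x))))"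
    if "\<bar>x\<bar> < pi" "slope0 sin (of_real x) = of_real t" "t > 0" for x t
  proof -
    have "exp (l (of_real x)) = of_real t" using that by (simp add: exp_l)
    then have "norm (exp (l (of_real x))) = t" using that(3) by simp
    then have "ln t = Re (l (of_real x))" by (simp add: ln_unique)
    moreover have "m (of_real x) = of_real (Re (l (of_real x)))"
      by (simp add: m_def complex_add_cnj)
    ultimately show ?thesis using that by simp
  qed
  moreover have "m 0 = 0" using m_real[of 0 1] by (simp add: slope0_sin)
  moreover have "m (of_real x) = of_real (ln (sin x / x))" if "\<bar>x\<bar> < pi" "x \<noteq> 0" for x
    using that m_real[of x "sin x / x"] sinc_pos[of x] by (simp add: slope0_sin sin_of_real)
  moreover have "exp (2 * m z) = slope0 sin z ^ 2" if "z \<in> ball 0 pi" for z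
  proof -
    have "2 * m z = l z + cnj (l (cnj z))" by (simp add: m_def)
    then show ?thesis
      using that exp_l[of z] exp_l[of "cnj z"]
      by (simp add: exp_add exp_cnj[symmetric] slope0_sin_cnj power2_eq_square)
  qed
  ultimately show ?thesis using that by blast
qed

lemma fps_exp_compose_nth:
  fixes K :: "'a::field_char_0 fps"
  assumes "fps_nth K 0 = 0"
  shows "fps_nth (fps_exp c oo K) 0 = 1"
    and "fps_nth (fps_exp c oo K) 1 = c * fps_nth K 1"
    and "fps_nth (fps_exp c oo K) 2 = c * fps_nth K 2 + c\<^sup>2 / 2 * (fps_nth K 1)\<^sup>2"
    and "fps_nth (fps_exp c oo K) 3 =
           c * fps_nth K 3 + c\<^sup>2 * (fps_nth K 1 * fps_nth K 2) + c ^ 3 / 6 * fps_nth K 1 ^ 3"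
    and "fps_nth (fps_exp c oo K) 4 =
           c * fps_nth K 4 + c\<^sup>2 / 2 * (2 * fps_nth K 1 * fps_nth K 3 + (fps_nth K 2)\<^sup>2)
           + c ^ 3 / 2 * ((fps_nth K 1)\<^sup>2 * fps_nth K 2) + c ^ 4 / 24 * fps_nth K 1 ^ 4"
  using assms
  by (simp_all add: fps_compose_nth fps_mult_nth eval_nat_numeral) (simp_all add: field_simps)

text \<open>
  Comparing coefficients determines a series \<open>M\<close> with \<open>e\<^bsup>2M\<^esup> = (sin z / z)\<^sup>2\<close> and zero constant term;
  \<open>fps_shift 1 (fps_sin 1)\<close> is the series of \<open>sin z / z\<close>.
\<close>

lemma log_sinc_fps_nth:
  fixes M :: "complex fps"
  assumes "fps_nth M 0 = 0"
    and "fps_exp 2 oo M = (fps_shift 1 (fps_sin 1)) ^ 2"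
  shows "fps_nth M 1 = 0" "fps_nth M 2 = - 1 / 6" "fps_nth M 3 = 0" "fps_nth M 4 = - 1 / 180"
proof -
  define T :: "complex fps" where "T = fps_shift 1 (fps_sin 1)"
  define S where "S = T ^ 2"
  have square:
    "fps_nth (F\<^sup>2) 1 = 2 * fps_nth F 0 * fps_nth F 1"
    "fps_nth (F\<^sup>2) 2 = 2 * fps_nth F 0 * fps_nth F 2 + (fps_nth F 1)\<^sup>2"
    "fps_nth (F\<^sup>2) 3 = 2 * fps_nth F 0 * fps_nth F 3 + 2 * fps_nth F 1 * fps_nth F 2"
    "fps_nth (F\<^sup>2) 4 =
       2 * fps_nth F 0 * fps_nth F 4 + 2 * fps_nth F 1 * fps_nth F 3 + (fps_nth F 2)\<^sup>2"
    for F :: "complex fps"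
    by (simp_all add: power2_eq_square fps_mult_nth eval_nat_numeral)
  have T: "fps_nth T 0 = 1" "fps_nth T 1 = 0" "fps_nth T 2 = - 1 / 6" "fps_nth T 3 = 0"
    "fps_nth T 4 = 1 / 120"
    by (simp_all add: T_def fps_sin_def fact_numeral)
  have S: "fps_nth S 1 = 0" "fps_nth S 2 = - 1 / 3" "fps_nth S 3 = 0" "fps_nth S 4 = 2 / 45"
    unfolding S_def square T by (simp_all add: power2_eq_square)
  note eq = fps_exp_compose_nth[OF assms(1), of 2, unfolded assms(2), folded T_def, folded S_def]
  show 1: "fps_nth M 1 = 0" using eq(2) S(1) by simp
  show 2: "fps_nth M 2 = - 1 / 6" using eq(3) S(2) 1 by (simp add: field_simps)
  show 3: "fps_nth M 3 = 0" using eq(4) S(3) 1 by simp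
  \<comment> \<open>The term \<open>1 / 36\<close> is the square of \<open>fps_nth M 2\<close>.\<close>
  have "2 * fps_nth M 4 + 2 * (1 / 36) = 2 / 45"
    using eq(5) S(4) unfolding 1 2 by (simp add: power2_eq_square)
  then have "2 * fps_nth M 4 = 2 / 45 - 2 * (1 / 36)" by (simp only: eq_diff_eq)
  also have "\<dots> = 2 * (- 1 / 180)" by simp
  finally show "fps_nth M 4 = - 1 / 180" by (simp only: mult_cancel_left) simp
qed

section \<open>The holomorphic extension of the shifted eigenvalue\<close>

lemma plap_eigenvalue_pi_div:
  assumes "\<bar>x\<bar> < pi" "x \<noteq> 0"
  shows "plap_eigenvalue (pi / x) = (pi / x - 1) * exp (- pi * (ln (sin x / x) / x))"
proof -
  have "pi / (pi / x * sin (pi / (pi / x))) = inverse (sin x / x)"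
    using assms by (simp add: field_simps)
  moreover have "inverse (sin x / x) > 0"
    using sinc_pos[OF assms] by (simp del: inverse_divide)
  moreover have "sin x \<noteq> 0" using sinc_pos[OF assms] by auto
  ultimately show ?thesis
    using sinc_pos[OF assms] assms by (simp add: plap_eigenvalue_def powr_def ln_inverse del: inverse_divide)
qed

lemma ex_shifted_eigenvalue_extension:
  obtains F C
  where "F holomorphic_on ball 0 pi" "F has_fps_expansion C"
    and "\<And>x. \<bar>x\<bar> < pi \<Longrightarrow> x \<noteq> 0 \<Longrightarrow> F (of_real x) = of_real (plap_eigenvalue (pi / x) - pi / x)"
    and "fps_nth C 0 = of_real (pi ^ 2 / 6 - 1)"
    and "fps_nth C 1 = of_real (pi ^ 3 / 72 - pi / 6)"
    and "fps_nth C 2 = of_real (pi ^ 4 / 1296 - pi ^ 2 / 120)"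
proof -
  obtain m where m: "m holomorphic_on ball 0 pi" "m 0 = 0"
    and m_real: "\<And>x. \<bar>x\<bar> < pi \<Longrightarrow> x \<noteq> 0 \<Longrightarrow> m (of_real x) = of_real (ln (sin x / x))"
    and exp_m: "\<And>z. z \<in> ball 0 pi \<Longrightarrow> exp (2 * m z) = slope0 sin z ^ 2"
    using ex_log_sinc by blast
  define M where "M = fps_expansion m 0"
  have mM: "m has_fps_expansion M"
    unfolding M_def using m(1) by (intro has_fps_expansion_fps_expansion[of "ball 0 pi"]) auto
  have M0: "fps_nth M 0 = 0" using m(2) by (simp add: M_def fps_expansion_def)
  have "((\<lambda>z. exp (2 * z)) \<circ> m) has_fps_expansion (fps_exp 2 oo M)"
    using mM M0 by (intro fps_expansion_intros)
  moreover have "((\<lambda>z. exp (2 * z)) \<circ> m) has_fps_expansion (fps_shift 1 (fps_sin 1)) ^ 2"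
  proof -
    have "eventually (\<lambda>z. z \<in> ball 0 pi) (nhds (0::complex))"
      by (intro eventually_nhds_in_open) auto
    then have "eventually (\<lambda>z. ((\<lambda>z. exp (2 * z)) \<circ> m) z = slope0 sin z ^ 2) (nhds 0)"
      by eventually_elim (simp add: exp_m)
    moreover have "(\<lambda>z. slope0 sin z ^ 2) has_fps_expansion (fps_shift 1 (fps_sin 1)) ^ 2"
      by (intro has_fps_expansion_power slope0_has_fps_expansion has_fps_expansion_sin')
    ultimately show ?thesis by (subst has_fps_expansion_cong[OF _ refl])
  qed
  ultimately have "fps_exp 2 oo M = (fps_shift 1 (fps_sin 1)) ^ 2"
    by (rule fps_expansion_unique_complex)
  note M = log_sinc_fps_nth[OF M0 this]

  \<comment> \<open>\<open>G\<close> extends the power in the closed form, and \<open>F\<close> extends the shifted eigenvalue; since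
     \<open>G 0 = 1\<close>, the simple pole of the term \<open>\<pi> / x\<close> is exactly absorbed by the difference quotient of \<open>G\<close>.\<close>
  define E where "E = (\<lambda>z. - of_real pi * slope0 m z)"
  define G where "G = (\<lambda>z. exp (E z))"
  define F where "F = (\<lambda>z. of_real pi * slope0 G z - G z)"
  define K where "K = fps_const (- of_real pi) * fps_shift 1 M"
  define L where "L = fps_exp 1 oo K"
  define C where "C = fps_const (of_real pi) * fps_shift 1 L - L"
  have "E holomorphic_on ball 0 pi"
    unfolding E_def by (intro holomorphic_intros slope0_holomorphic m) auto
  then have G: "G holomorphic_on ball 0 pi"
    unfolding G_def by (intro holomorphic_intros)
  then have holF: "F holomorphic_on ball 0 pi"
    unfolding F_def by (intro holomorphic_intros slope0_holomorphic) auto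

  have K: "E has_fps_expansion K"
    unfolding E_def K_def by (intro fps_expansion_intros slope0_has_fps_expansion mM)
  have K0: "fps_nth K 0 = 0" "fps_nth K 1 = of_real pi / 6" "fps_nth K 2 = 0"
    "fps_nth K 3 = of_real pi / 180"
    using M by (simp_all add: K_def eval_nat_numeral)
  have "(exp \<circ> E) has_fps_expansion L"
    unfolding L_def using K K0(1) by (intro fps_expansion_intros)
  then have L: "G has_fps_expansion L" by (simp add: G_def o_def)
  then have C: "F has_fps_expansion C"
    unfolding F_def C_def by (intro fps_expansion_intros slope0_has_fps_expansion)

  have G0: "G 0 = 1"
    using K0(1) has_fps_expansion_imp_0_eq_fps_nth_0[OF K] by (simp add: G_def)
  have F_real: "F (of_real x) = of_real (plap_eigenvalue (pi / x) - pi / x)"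
    if x: "\<bar>x\<bar> < pi" "x \<noteq> 0" for x
  proof -
    define e where "e = exp (- pi * (ln (sin x / x) / x))"
    have "E (of_real x) = of_real (- pi * (ln (sin x / x) / x))"
      using x m(2) by (simp add: E_def slope0_def m_real)
    then have "G (of_real x) = of_real e" by (simp only: G_def e_def exp_of_real)
    then have "F (of_real x) = of_real (pi * ((e - 1) / x) - e)"
      using x by (simp add: F_def slope0_def G0)
    also have "pi * ((e - 1) / x) - e = plap_eigenvalue (pi / x) - pi / x"
      using x by (simp add: plap_eigenvalue_pi_div e_def field_simps)
    finally show ?thesis .
  qed

  have L_nth: "fps_nth L 0 = 1" "fps_nth L 1 = of_real pi / 6" "fps_nth L 2 = of_real pi ^ 2 / 72"
    "fps_nth L 3 = of_real pi / 180 + of_real pi ^ 3 / 1296"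
    unfolding L_def fps_exp_compose_nth[OF K0(1)] K0 by (simp_all add: eval_nat_numeral)
  have "fps_nth C 0 = of_real (pi ^ 2 / 6 - 1)"
    "fps_nth C 1 = of_real (pi ^ 3 / 72 - pi / 6)"
    "fps_nth C 2 = of_real (pi ^ 4 / 1296 - pi ^ 2 / 120)"
    using L_nth by (simp_all add: C_def eval_nat_numeral field_simps)
  with holF C F_real show ?thesis using that by blast
qed

section \<open>The Maclaurin series of the shifted eigenvalue\<close>

theorem theorem1p5:
  fixes c :: "nat \<Rightarrow> real"
  defines "c \<equiv> maclaurin_coeff shifted_eigenvalue"
  shows "((\<lambda>x. plap_eigenvalue (pi / x) - pi / x) \<longlongrightarrow> shifted_eigenvalue 0) (at 0)
    \<and> real_analytic_on shifted_eigenvalue {- pi<..<pi}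
    \<and> c 0 = pi ^ 2 / 6 - 1
    \<and> c 1 = pi ^ 3 / 72 - pi / 6
    \<and> c 2 = pi ^ 4 / 1296 - pi ^ 2 / 120
    \<and> (\<forall>x\<in>{- pi<..<pi}. (\<lambda>n. c n * x ^ n) sums shifted_eigenvalue x)
    \<and> (\<forall>p>1. summable (\<lambda>n. c n * (pi / p) ^ n)
           \<and> plap_eigenvalue p = p + (\<Sum>n. c n * (pi / p) ^ n))"
proof -
  let ?raw = "\<lambda>x. plap_eigenvalue (pi / x) - pi / x"
  obtain F C where F: "F holomorphic_on ball 0 pi" and C: "F has_fps_expansion C"
    and F_real: "\<And>x. \<bar>x\<bar> < pi \<Longrightarrow> x \<noteq> 0 \<Longrightarrow> F (of_real x) = of_real (?raw x)"
    and C_nth: "fps_nth C 0 = of_real (pi ^ 2 / 6 - 1)"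
      "fps_nth C 1 = of_real (pi ^ 3 / 72 - pi / 6)"
      "fps_nth C 2 = of_real (pi ^ 4 / 1296 - pi ^ 2 / 120)"
    using ex_shifted_eigenvalue_extension by blast
  have C_eq: "C = fps_expansion F 0"
    using C F by (intro fps_expansion_unique_complex[OF C] has_fps_expansion_fps_expansion[of "ball 0 pi"]) auto

  have lim0: "(?raw \<longlongrightarrow> Re (F 0)) (at 0)"
  proof -
    have F0: "isCont F 0" using has_fps_expansion_imp_continuous[OF C, of UNIV] by simp
    have "((\<lambda>x::real. complex_of_real x) \<longlongrightarrow> 0) (at 0)"
      using tendsto_of_real[OF tendsto_ident_at[of 0 UNIV]] by simp
    from isCont_tendsto_compose[OF F0 this] have "((\<lambda>x::real. Re (F (of_real x))) \<longlongrightarrow> Re (F 0)) (at 0)"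
      by (rule tendsto_Re)
    moreover have "eventually (\<lambda>x. Re (F (of_real x)) = ?raw x) (at 0)"
      unfolding eventually_at by (rule exI[of _ pi]) (simp add: F_real)
    ultimately show ?thesis using Lim_transform_eventually by fastforce
  qed
  have shifted_0: "shifted_eigenvalue 0 = Re (F 0)"
    using tendsto_Lim[OF at_neq_bot lim0] by (simp add: shifted_eigenvalue_def)
  have shifted_eq: "shifted_eigenvalue x = Re (F (of_real x))" if "\<bar>x\<bar> < pi" for x
    using that F_real[of x] shifted_0 by (cases "x = 0") (simp_all add: shifted_eigenvalue_def)

  have sums_C: "(\<lambda>n. Re (fps_nth C n) * x ^ n) sums shifted_eigenvalue x" if "\<bar>x\<bar> < pi" for x
    using sums_Re_of_holomorphic[of F 0 pi x] F that by (simp add: C_eq shifted_eq)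
  have "eventually (\<lambda>x. x \<in> ball 0 pi) (nhds (0::real))"
    by (intro eventually_nhds_in_open) auto
  then have "shifted_eigenvalue has_fps_expansion Abs_fps (\<lambda>n. Re (fps_nth C n))"
    by (intro has_fps_expansionI) (auto elim!: eventually_mono intro: sums_C)
  then have c_eq: "c n = Re (fps_nth C n)" for n
    using real_has_fps_expansion_nth by (fastforce simp: c_def maclaurin_coeff_def)

  have sums_c: "(\<lambda>n. c n * x ^ n) sums shifted_eigenvalue x" if "\<bar>x\<bar> < pi" for x
    using sums_C[OF that] by (simp add: c_eq)
  have "summable (\<lambda>n. c n * (pi / p) ^ n) \<and> plap_eigenvalue p = p + (\<Sum>n. c n * (pi / p) ^ n)"
    if p: "p > 1" for p
  proof -
    have "\<bar>pi / p\<bar> < pi" using p by (simp add: field_simps)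
    from sums_c[OF this] show ?thesis
      using p by (simp add: sums_iff shifted_eigenvalue_def)
  qed
  moreover have "real_analytic_on shifted_eigenvalue {- pi<..<pi}"
    using F by (rule real_analytic_on_Re_holomorphic) (auto simp: shifted_eq)
  moreover have "c 0 = pi ^ 2 / 6 - 1" "c 1 = pi ^ 3 / 72 - pi / 6"
    "c 2 = pi ^ 4 / 1296 - pi ^ 2 / 120"
    unfolding c_eq C_nth by (simp_all only: Re_complex_of_real)
  moreover have "(?raw \<longlongrightarrow> shifted_eigenvalue 0) (at 0)"
    using lim0 shifted_0 by simp
  ultimately show ?thesis using sums_c by auto
qed

end
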